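(* Let $n\in\mathbb{N}$, let $\phi=(\phi_1,\dots,\phi_n):U^n\to U^n$ be holomorphic, and let $p,q>0$. Then $C_\phi$ is a bounded operator from $\mathcal{B}^p_0(U^n)$ to $\mathcal{B}^q_0(U^n)$ if and only if both of the following hold: (a) $\phi^\gamma\in\mathcal{B}^q_0(U^n)$ for every $n$-multi-index $\gamma$; (b) there exists a constant $C$ such that for all $z\in U^n$, $$\sum_{k,l=1}^n\left|\frac{\partial \phi_l}{\partial z_k}(z)\right|\frac{(1-|z_k|^2)^q}{(1-|\phi_l(z)|^2)^p}\le C.$$
   Context: $U$ is the open unit disk in $\mathbb{C}$ and $U^n\subset\mathbb{C}^n$ is the open unit polydisk. For a holomorphic self-map $\phi$ of $U^n$, the composition operator is $C_\phi f=f\circ\phi$ for $f$ holomorphic on $U^n$. An $n$-multi-index is an $n$-tuple $\gamma=(\gamma_1,\dots,\gamma_n)$ of nonnegative integers, and $\phi^\gamma=\phi_1^{\gamma_1}\phi_2^{\gamma_2}\cdots\phi_n^{\gamma_n}$. For $p>0$, the $p$-Bloch space $\mathcal{B}^p(U^n)$ is the Banach space of holomorphic $f:U^n\to\mathbb{C}$ with finite norm $$\|f\|_{\mathcal{B}^p}=|f(0)|+\sup_{z\in U^n}\sum_{k=1}^n\left|\frac{\partial f}{\partial z_k}(z)\right|(1-|z_k|^2)^p .$$ The little $p$-Bloch space $\mathcal{B}^p_0(U^n)$ is the closure of the polynomials in $\mathcal{B}^p(U^n)$, with the same norm. Saying $C_\phi$ is a bounded operator from $X$ to $Y$ means that $C_\phi$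 maps $X$ into $Y$ and is bounded for the respective norms. *)

theory Defs
  imports "HOL-Analysis.Analysis"
begin

definition polydisk :: "(complex ^ 'n) set" where
  "polydisk = {z. \<forall>i. cmod (z $ i) < 1}"

text \<open>Holomorphy in several variables: the Frechet derivative, which \<open>has_derivative\<close> only
  makes real-linear, exists and is complex-linear at every point (of an open set).\<close>

definition holomorphic_several :: "(complex ^ 'n \<Rightarrow> complex) \<Rightarrow> (complex ^ 'n) set \<Rightarrow> bool" where
  "holomorphic_several f S \<longleftrightarrow>
     (\<forall>z\<in>S. \<exists>D. (f has_derivative D) (at z) \<and> (\<forall>c v. D (c *s v) = c * D v))"

definition holomorphic_self_map :: "(complex ^ 'n \<Rightarrow> complex ^ 'n) \<Rightarrow> bool" where
  "holomorphic_self_map \<phi> \<longleftrightarrow>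
     (\<forall>l. holomorphic_several (\<lambda>z. \<phi> z $ l) polydisk) \<and> \<phi> ` polydisk \<subseteq> polydisk"

definition partial_deriv :: "'n \<Rightarrow> (complex ^ 'n \<Rightarrow> complex) \<Rightarrow> complex ^ 'n \<Rightarrow> complex" where
  "partial_deriv k f z = deriv (\<lambda>w. f (\<chi> i. if i = k then w else z $ i)) (z $ k)"

definition multi_power :: "complex ^ 'n \<Rightarrow> ('n \<Rightarrow> nat) \<Rightarrow> complex" where
  "multi_power z \<gamma> = (\<Prod>i\<in>UNIV. (z $ i) ^ \<gamma> i)"

definition complex_polynomials :: "(complex ^ 'n \<Rightarrow> complex) set" where
  "complex_polynomials =
     {f. \<exists>(A :: ('n \<Rightarrow> nat) set) a. finite A \<and> f = (\<lambda>z. \<Sum>\<gamma>\<in>A. a \<gamma> * multi_power z \<gamma>)}"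

text \<open>Functions on the polydisk are represented by total functions whose values outside of it are
  irrelevant: each notion below depends only on the restriction to the polydisk.\<close>

definition bloch_density :: "real \<Rightarrow> (complex ^ 'n \<Rightarrow> complex) \<Rightarrow> complex ^ 'n \<Rightarrow> real" where
  "bloch_density p f z =
     (\<Sum>k\<in>UNIV. cmod (partial_deriv k f z) * (1 - (cmod (z $ k))\<^sup>2) powr p)"

definition bloch :: "real \<Rightarrow> (complex ^ 'n \<Rightarrow> complex) set" where
  "bloch p = {f. holomorphic_several f polydisk \<and> bdd_above (bloch_density p f ` polydisk)}"

text \<open>The real-valued supremum is meaningful only for members of \<open>bloch p\<close>.\<close>

definition bloch_norm :: "real \<Rightarrow> (complex ^ 'n \<Rightarrow> complex) \<Rightarrow> real" where
  "bloch_norm p f = cmod (f 0) + (SUP z\<in>polydisk. bloch_density p f z)"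

text \<open>Closure of the polynomials with respect to \<open>bloch_norm p\<close>; for \<open>p > 0\<close> all polynomials
  belong to \<open>bloch p\<close>, so the norm is only applied to members of \<open>bloch p\<close>.\<close>

definition little_bloch :: "real \<Rightarrow> (complex ^ 'n \<Rightarrow> complex) set" where
  "little_bloch p =
     {f \<in> bloch p. \<forall>\<epsilon>>0. \<exists>P\<in>complex_polynomials. bloch_norm p (\<lambda>z. f z - P z) < \<epsilon>}"

definition composition_operator ::
    "(complex ^ 'n \<Rightarrow> complex ^ 'n) \<Rightarrow> (complex ^ 'n \<Rightarrow> complex) \<Rightarrow> complex ^ 'n \<Rightarrow> complex" where
  "composition_operator \<phi> f = f \<circ> \<phi>"

definition bounded_operator ::
    "('a \<Rightarrow> 'b) \<Rightarrow> 'a set \<Rightarrow> ('a \<Rightarrow> real) \<Rightarrow> 'b set \<Rightarrow> ('b \<Rightarrow> real) \<Rightarrow> bool" where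
  "bounded_operator T X normX Y normY \<longleftrightarrow>
     (\<forall>f\<in>X. T f \<in> Y) \<and> (\<exists>K. \<forall>f\<in>X. normY (T f) \<le> K * normX f)"

end

theory Submission
  imports Defs
begin

text \<open>By the chain rule, condition (b) bounds the density of \<open>f \<circ> \<phi>\<close> by a multiple of the norm of
  \<open>f\<close>, while integration along a segment controls \<open>f (\<phi> 0)\<close>; so \<open>C\<^sub>\<phi>\<close> is bounded on the whole
  Bloch space, and (a) together with a density argument keeps it inside the little Bloch space.
  Conversely, fix \<open>z\<close> and \<open>l\<close>, put \<open>a = \<phi>\<^sub>l(z)\<close> and take for \<open>f\<close> the primitive of
  \<open>t \<mapsto> (1 - cnj a * t) powr (-p)\<close> in the \<open>l\<close>-th variable. Its norm is at most \<open>2 powr p\<close>, and it lies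
  in the little space because its power series converges beyond the closed disk; evaluating the
  density of \<open>f \<circ> \<phi>\<close> at \<open>z\<close> itself gives the \<open>l\<close>-th part of the sum in (b).\<close>

subsection \<open>Partial derivatives and holomorphy\<close>

text \<open>The vectors of \<open>Basis\<close> in \<open>complex ^ 'n\<close> have the form
  \<open>axis i u\<close>, so an inner product with one of them sees only the \<open>i\<close>-th
  coordinate. This allows differentiation by complex instead of real coordinates.\<close>

lemma has_derivative_vecI:
  fixes f :: "'a::real_normed_vector \<Rightarrow> complex ^ 'n"
  assumes "\<And>i. ((\<lambda>x. f x $ i) has_derivative (\<lambda>h. f' h $ i)) (at x within S)"
  shows "(f has_derivative f') (at x within S)"
proof (subst has_derivative_componentwise_within, intro ballI)
  fix b :: "complex ^ 'n"
  assume "b \<in> Basis"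
  then obtain i u where b: "b = axis i u"
    by (auto simp: Basis_vec_def)
  show "((\<lambda>x. f x \<bullet> b) has_derivative (\<lambda>x. f' x \<bullet> b)) (at x within S)"
    using has_derivative_inner_left[OF assms[of i], of u] by (simp add: b inner_axis)
qed

text \<open>The chain rule along the coordinate line through \<open>z\<close>, whose derivative is
  \<open>axis k\<close>, picks out the \<open>k\<close>-th coefficient.\<close>

lemma partial_deriv_eqI:
  fixes f :: "complex ^ 'n \<Rightarrow> complex"
  assumes "(f has_derivative (\<lambda>v. \<Sum>j\<in>UNIV. c j * v $ j)) (at z)"
  shows "partial_deriv k f z = c k"
proof -
  let ?path = "\<lambda>w. \<chi> i. if i = k then w else z $ i"
  have path: "(?path has_derivative axis k) (at (z $ k))"
  proof (rule has_derivative_vecI)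
    fix i
    show "((\<lambda>w. ?path w $ i) has_derivative (\<lambda>h. axis k h $ i)) (at (z $ k))"
      by (cases "i = k") (auto simp: axis_def)
  qed
  have "?path (z $ k) = z"
    by (simp add: vec_eq_iff)
  with assms have "(f has_derivative (\<lambda>v. \<Sum>j\<in>UNIV. c j * v $ j)) (at (?path (z $ k)))"
    by simp
  from diff_chain_at[OF path this]
  have "((\<lambda>w. f (?path w)) has_derivative (\<lambda>h. \<Sum>j\<in>UNIV. c j * axis k h $ j)) (at (z $ k))"
    by (simp add: o_def)
  moreover have "(\<lambda>h. \<Sum>j\<in>UNIV. c j * axis k h $ j) = (*) (c k)"
    by (auto simp: axis_def if_distrib cong: if_cong)
  ultimately have "((\<lambda>w. f (?path w)) has_field_derivative c k) (at (z $ k))"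
    by (simp add: has_field_derivative_def)
  then show ?thesis
    unfolding partial_deriv_def by (rule DERIV_imp_deriv)
qed

lemma complex_linear_cart:
  fixes D :: "complex ^ 'n \<Rightarrow> complex"
  assumes "linear D" and "\<And>c v. D (c *s v) = c * D v"
  shows "D v = (\<Sum>k\<in>UNIV. D (axis k 1) * v $ k)"
proof -
  have "D v = D (\<Sum>k\<in>UNIV. v $ k *s axis k 1)"
    by (simp add: basis_expansion)
  also have "\<dots> = (\<Sum>k\<in>UNIV. D (v $ k *s axis k 1))"
    using assms(1) by (rule linear_sum)
  finally show ?thesis
    by (simp add: assms(2) mult.commute)
qed

text \<open>A complex-linear derivative is determined by its values at the vectors
  \<open>axis k 1\<close>, and these values are the partial derivatives. In this gradient form the
  rules for sums, multiples and compositions become identities between coefficients.\<close>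

lemma holomorphic_several_iff:
  fixes f :: "complex ^ 'n \<Rightarrow> complex"
  shows "holomorphic_several f S \<longleftrightarrow>
    (\<forall>z\<in>S. (f has_derivative (\<lambda>v. \<Sum>k\<in>UNIV. partial_deriv k f z * v $ k)) (at z))"
    (is "_ \<longleftrightarrow> ?R")
proof
  assume hol: "holomorphic_several f S"
  show ?R
  proof
    fix z assume "z \<in> S"
    with hol obtain D where D: "(f has_derivative D) (at z)" "\<And>c v. D (c *s v) = c * D v"
      by (auto simp: holomorphic_several_def)
    have eq: "D = (\<lambda>v. \<Sum>k\<in>UNIV. D (axis k 1) * v $ k)"
      using complex_linear_cart[of D] D has_derivative_linear by blast
    have "D (axis k 1) = partial_deriv k f z" for k
      using partial_deriv_eqI[of f "\<lambda>k. D (axis k 1)" z k] D(1) eq by simp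
    with eq have "D = (\<lambda>v. \<Sum>k\<in>UNIV. partial_deriv k f z * v $ k)"
      by simp
    with D(1) show "(f has_derivative (\<lambda>v. \<Sum>k\<in>UNIV. partial_deriv k f z * v $ k)) (at z)"
      by simp
  qed
next
  assume R: ?R
  show "holomorphic_several f S"
    unfolding holomorphic_several_def
  proof
    fix z assume "z \<in> S"
    with R show "\<exists>D. (f has_derivative D) (at z) \<and> (\<forall>c v. D (c *s v) = c * D v)"
      by (intro exI[of _ "\<lambda>v. \<Sum>k\<in>UNIV. partial_deriv k f z * v $ k"])
         (auto simp: sum_distrib_left mult_ac)
  qed
qed

text \<open>The coefficients may be arbitrary, so one computation of a derivative, used here and in
  \<open>partial_deriv_eqI\<close>, gives both holomorphy and the values of the partial
  derivatives.\<close>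

lemma holomorphic_severalI:
  fixes f :: "complex ^ 'n \<Rightarrow> complex"
  assumes "\<And>z. z \<in> S \<Longrightarrow> (f has_derivative (\<lambda>v. \<Sum>k\<in>UNIV. c z k * v $ k)) (at z)"
  shows "holomorphic_several f S"
  unfolding holomorphic_several_iff using assms partial_deriv_eqI[OF assms] by simp

lemma holomorphic_several_const: "holomorphic_several (\<lambda>z. c) S"
  unfolding holomorphic_several_def by (auto intro!: exI[of _ "\<lambda>v. 0"])

lemma holomorphic_several_nth: "holomorphic_several (\<lambda>z. z $ i) S"
  unfolding holomorphic_several_def
  by (auto intro!: exI[of _ "\<lambda>v. v $ i"] bounded_linear_imp_has_derivative)

lemma holomorphic_several_mult:
  assumes "holomorphic_several f S" and "holomorphic_several g S"
  shows "holomorphic_several (\<lambda>z. f z * g z) S"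
  unfolding holomorphic_several_def
proof
  fix z assume "z \<in> S"
  with assms obtain D E where
    D: "(f has_derivative D) (at z)" "\<And>c v. D (c *s v) = c * D v" and
    E: "(g has_derivative E) (at z)" "\<And>c v. E (c *s v) = c * E v"
    unfolding holomorphic_several_def by blast
  then show "\<exists>D. ((\<lambda>z. f z * g z) has_derivative D) (at z) \<and> (\<forall>c v. D (c *s v) = c * D v)"
    by (intro exI[of _ "\<lambda>v. f z * E v + D v * g z"])
       (auto intro: has_derivative_mult, auto simp: algebra_simps)
qed

lemma holomorphic_several_power:
  "holomorphic_several f S \<Longrightarrow> holomorphic_several (\<lambda>z. f z ^ n) S"
  by (induction n) (auto intro: holomorphic_several_const holomorphic_several_mult)

lemma holomorphic_several_prod:
  "(\<And>i. i \<in> A \<Longrightarrow> holomorphic_several (f i) S) \<Longrightarrow> holomorphic_several (\<lambda>z. \<Prod>i\<in>A. f i z) S"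
  by (induction A rule: infinite_finite_induct)
     (auto intro: holomorphic_several_const holomorphic_several_mult)

lemma holomorphic_several_multi_power: "holomorphic_several (\<lambda>z. multi_power z \<gamma>) S"
  unfolding multi_power_def
  by (intro holomorphic_several_prod holomorphic_several_power holomorphic_several_nth)

lemma
  fixes f g :: "complex ^ 'n \<Rightarrow> complex"
  assumes "holomorphic_several f S" and "holomorphic_several g S"
  shows holomorphic_several_add: "holomorphic_several (\<lambda>z. f z + g z) S"
    and partial_deriv_add: "z \<in> S \<Longrightarrow>
      partial_deriv k (\<lambda>z. f z + g z) z = partial_deriv k f z + partial_deriv k g z"
proof -
  have D: "((\<lambda>z. f z + g z) has_derivative
      (\<lambda>v. \<Sum>k\<in>UNIV. (partial_deriv k f z + partial_deriv k g z) * v $ k)) (at z)" if "z \<in> S" for z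
    using assms that unfolding holomorphic_several_iff
    by (auto intro!: derivative_eq_intros simp: sum.distrib distrib_right)
  show "holomorphic_several (\<lambda>z. f z + g z) S"
    using D by (rule holomorphic_severalI)
  show "z \<in> S \<Longrightarrow>
      partial_deriv k (\<lambda>z. f z + g z) z = partial_deriv k f z + partial_deriv k g z"
    by (rule partial_deriv_eqI[OF D])
qed

lemma
  fixes f :: "complex ^ 'n \<Rightarrow> complex"
  assumes "holomorphic_several f S"
  shows holomorphic_several_scale: "holomorphic_several (\<lambda>z. c * f z) S"
    and partial_deriv_scale: "z \<in> S \<Longrightarrow> partial_deriv k (\<lambda>z. c * f z) z = c * partial_deriv k f z"
proof -
  have D: "((\<lambda>z. c * f z) has_derivative (\<lambda>v. \<Sum>k\<in>UNIV. (c * partial_deriv k f z) * v $ k)) (at z)"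
    if "z \<in> S" for z
    using assms that unfolding holomorphic_several_iff
    by (auto intro!: derivative_eq_intros simp: sum_distrib_left mult.assoc)
  show "holomorphic_several (\<lambda>z. c * f z) S"
    using D by (rule holomorphic_severalI)
  show "z \<in> S \<Longrightarrow> partial_deriv k (\<lambda>z. c * f z) z = c * partial_deriv k f z"
    by (rule partial_deriv_eqI[OF D])
qed

text \<open>The real chain rule composes the two gradients; exchanging the sums over
  \<open>k\<close> and \<open>l\<close> collects the coefficient of each
  \<open>v $ k\<close>.\<close>

lemma
  fixes f :: "complex ^ 'n \<Rightarrow> complex" and \<phi> :: "complex ^ 'm \<Rightarrow> complex ^ 'n"
  assumes f: "holomorphic_several f T" and \<phi>: "\<And>l. holomorphic_several (\<lambda>z. \<phi> z $ l) S"
    and "\<phi> ` S \<subseteq> T"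
  shows holomorphic_several_compose: "holomorphic_several (\<lambda>z. f (\<phi> z)) S"
    and partial_deriv_compose: "z \<in> S \<Longrightarrow> partial_deriv k (\<lambda>z. f (\<phi> z)) z =
      (\<Sum>l\<in>UNIV. partial_deriv l f (\<phi> z) * partial_deriv k (\<lambda>z. \<phi> z $ l) z)"
proof -
  have D: "((\<lambda>z. f (\<phi> z)) has_derivative
      (\<lambda>v. \<Sum>k\<in>UNIV. (\<Sum>l\<in>UNIV. partial_deriv l f (\<phi> z) * partial_deriv k (\<lambda>z. \<phi> z $ l) z) * v $ k))
      (at z)" if "z \<in> S" for z
  proof -
    have "(\<phi> has_derivative (\<lambda>v. \<chi> l. \<Sum>k\<in>UNIV. partial_deriv k (\<lambda>z. \<phi> z $ l) z * v $ k)) (at z)"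
      using \<phi> that unfolding holomorphic_several_iff by (intro has_derivative_vecI) simp
    moreover have "(f has_derivative (\<lambda>v. \<Sum>l\<in>UNIV. partial_deriv l f (\<phi> z) * v $ l)) (at (\<phi> z))"
      using f that assms(3) unfolding holomorphic_several_iff by blast
    ultimately have "((\<lambda>z. f (\<phi> z)) has_derivative (\<lambda>v. \<Sum>l\<in>UNIV. partial_deriv l f (\<phi> z) *
        (\<Sum>k\<in>UNIV. partial_deriv k (\<lambda>z. \<phi> z $ l) z * v $ k))) (at z)"
      using diff_chain_at by (fastforce simp: o_def)
    moreover have "(\<Sum>l\<in>UNIV. partial_deriv l f (\<phi> z) *
        (\<Sum>k\<in>UNIV. partial_deriv k (\<lambda>z. \<phi> z $ l) z * v $ k)) =
      (\<Sum>k\<in>UNIV. (\<Sum>l\<in>UNIV. partial_deriv l f (\<phi> z) * partial_deriv k (\<lambda>z. \<phi> z $ l) z) * v $ k)" for v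
      unfolding sum_distrib_left sum_distrib_right mult.assoc by (rule sum.swap)
    ultimately show ?thesis
      by simp
  qed
  show "holomorphic_several (\<lambda>z. f (\<phi> z)) S"
    using D by (rule holomorphic_severalI)
  show "z \<in> S \<Longrightarrow> partial_deriv k (\<lambda>z. f (\<phi> z)) z =
      (\<Sum>l\<in>UNIV. partial_deriv l f (\<phi> z) * partial_deriv k (\<lambda>z. \<phi> z $ l) z)"
    by (rule partial_deriv_eqI[OF D])
qed

subsection \<open>Bloch spaces\<close>

lemma zero_in_polydisk: "0 \<in> polydisk"
  by (simp add: polydisk_def)

lemma open_polydisk: "open (polydisk :: (complex ^ 'n) set)"
proof -
  have "open (\<Inter>i\<in>UNIV. {z :: complex ^ 'n. cmod (z $ i) < 1})"
    by (intro open_INT ballI open_Collect_less continuous_intros finite)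
  also have "(\<Inter>i\<in>UNIV. {z :: complex ^ 'n. cmod (z $ i) < 1}) = polydisk"
    by (auto simp: polydisk_def)
  finally show ?thesis .
qed

lemma polydisk_weight:
  assumes "z \<in> polydisk"
  shows "0 < 1 - (cmod (z $ k))\<^sup>2" and "1 - (cmod (z $ k))\<^sup>2 \<le> 1"
  using assms by (auto simp: polydisk_def abs_square_less_1)

lemma polydisk_weight_powr_le_1: "z \<in> polydisk \<Longrightarrow> p > 0 \<Longrightarrow> (1 - (cmod (z $ k))\<^sup>2) powr p \<le> 1"
  using polydisk_weight[of z k] by (intro powr_le1) auto

lemma bloch_density_ge_term:
  fixes f :: "complex ^ 'n \<Rightarrow> complex"
  shows "cmod (partial_deriv k f z) * (1 - (cmod (z $ k))\<^sup>2) powr p \<le> bloch_density p f z"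
  unfolding bloch_density_def by (rule member_le_sum) auto

lemma bloch_density_add:
  fixes f g :: "complex ^ 'n \<Rightarrow> complex"
  assumes "holomorphic_several f S" "holomorphic_several g S" "z \<in> S"
  shows "bloch_density p (\<lambda>z. f z + g z) z \<le> bloch_density p f z + bloch_density p g z"
  unfolding bloch_density_def sum.distrib[symmetric] partial_deriv_add[OF assms]
    distrib_right[symmetric]
  by (intro sum_mono mult_right_mono norm_triangle_ineq) auto

lemma bloch_density_scale:
  fixes f :: "complex ^ 'n \<Rightarrow> complex"
  assumes "holomorphic_several f S" "z \<in> S"
  shows "bloch_density p (\<lambda>z. c * f z) z = cmod c * bloch_density p f z"
  unfolding bloch_density_def partial_deriv_scale[OF assms]
  by (simp add: norm_mult sum_distrib_left mult.assoc)

lemma bloch_norm_ge: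
  assumes "f \<in> bloch p" "z \<in> polydisk"
  shows "cmod (f 0) + bloch_density p f z \<le> bloch_norm p f"
  using assms unfolding bloch_def bloch_norm_def by (auto intro: cSUP_upper)

lemma bloch_norm_nonneg:
  assumes "f \<in> bloch p"
  shows "0 \<le> bloch_norm p f"
proof -
  have "0 \<le> bloch_density p f 0"
    unfolding bloch_density_def by (intro sum_nonneg) auto
  then show ?thesis
    using bloch_norm_ge[OF assms zero_in_polydisk] norm_ge_zero[of "f 0"] by linarith
qed

text \<open>Since the polydisk is open, equality on it passes to the derivatives. This serves for
  power series, whose identities hold only where they converge.\<close>

lemma bloch_norm_cong:
  fixes f g :: "complex ^ 'n \<Rightarrow> complex"
  assumes "holomorphic_several f polydisk" and eq: "\<And>z. z \<in> polydisk \<Longrightarrow> f z = g z"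
  shows "bloch_norm p f = bloch_norm p g"
proof -
  have "partial_deriv k g z = partial_deriv k f z" if z: "z \<in> polydisk" for z k
  proof (rule partial_deriv_eqI, rule has_derivative_transform_within_open[OF _ open_polydisk z eq])
    show "(f has_derivative (\<lambda>v. \<Sum>j\<in>UNIV. partial_deriv j f z * v $ j)) (at z)"
      using assms(1) z by (simp add: holomorphic_several_iff)
  qed
  then have "bloch_density p f z = bloch_density p g z" if "z \<in> polydisk" for z
    using that by (simp add: bloch_density_def)
  then show ?thesis
    using eq[OF zero_in_polydisk] by (simp add: bloch_norm_def cong: SUP_cong)
qed

lemma bloch_norm_le:
  assumes "\<And>z. z \<in> polydisk \<Longrightarrow> bloch_density p f z \<le> M"
  shows "bloch_norm p f \<le> cmod (f 0) + M"
  unfolding bloch_norm_def using zero_in_polydisk assms by (auto intro!: cSUP_least)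

lemma blochI:
  assumes "holomorphic_several f polydisk" "\<And>z. z \<in> polydisk \<Longrightarrow> bloch_density p f z \<le> M"
  shows "f \<in> bloch p"
  using assms unfolding bloch_def by (auto intro!: bdd_aboveI2)

lemma
  fixes f g :: "complex ^ 'n \<Rightarrow> complex"
  assumes f: "f \<in> bloch p" and g: "g \<in> bloch p"
  shows bloch_add: "(\<lambda>z. f z + g z) \<in> bloch p"
    and bloch_norm_add: "bloch_norm p (\<lambda>z. f z + g z) \<le> bloch_norm p f + bloch_norm p g"
proof -
  \<comment> \<open>Subtracting the values at 0 leaves bounds for the densities alone;
    \<open>bloch_norm_le\<close> then adds the value of the sum at 0.\<close>
  let ?M = "(bloch_norm p f - cmod (f 0)) + (bloch_norm p g - cmod (g 0))"
  have hol: "holomorphic_several f polydisk" "holomorphic_several g polydisk"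
    using f g by (auto simp: bloch_def)
  have *: "bloch_density p (\<lambda>z. f z + g z) z \<le> ?M" if "z \<in> polydisk" for z
    using bloch_density_add[OF hol that, of p] bloch_norm_ge[OF f that] bloch_norm_ge[OF g that]
    by linarith
  show "(\<lambda>z. f z + g z) \<in> bloch p"
    using holomorphic_several_add[OF hol] * by (rule blochI)
  show "bloch_norm p (\<lambda>z. f z + g z) \<le> bloch_norm p f + bloch_norm p g"
    using bloch_norm_le[of p "\<lambda>z. f z + g z", OF *] norm_triangle_ineq[of "f 0" "g 0"] by linarith
qed

lemma
  fixes f :: "complex ^ 'n \<Rightarrow> complex"
  assumes f: "f \<in> bloch p"
  shows bloch_scale: "(\<lambda>z. c * f z) \<in> bloch p"
    and bloch_norm_scale: "bloch_norm p (\<lambda>z. c * f z) \<le> cmod c * bloch_norm p f"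
proof -
  have hol: "holomorphic_several f polydisk"
    using f by (auto simp: bloch_def)
  have *: "bloch_density p (\<lambda>z. c * f z) z \<le> cmod c * (bloch_norm p f - cmod (f 0))"
    if "z \<in> polydisk" for z
    using bloch_norm_ge[OF f that] unfolding bloch_density_scale[OF hol that]
    by (intro mult_left_mono) auto
  show "(\<lambda>z. c * f z) \<in> bloch p"
    using holomorphic_several_scale[OF hol] * by (rule blochI)
  show "bloch_norm p (\<lambda>z. c * f z) \<le> cmod c * bloch_norm p f"
    using bloch_norm_le[of p "\<lambda>z. c * f z", OF *] by (simp add: norm_mult algebra_simps)
qed

lemma bloch_diff:
  fixes f g :: "complex ^ 'n \<Rightarrow> complex"
  assumes "f \<in> bloch p" "g \<in> bloch p"
  shows "(\<lambda>z. f z - g z) \<in> bloch p"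
  using bloch_add[OF assms(1) bloch_scale[OF assms(2), of "-1"]] by simp

section \<open>Polynomials and their membership in the Bloch spaces\<close>

lemma polynomials_scale:
  assumes "P \<in> complex_polynomials"
  shows "(\<lambda>z. c * P z) \<in> complex_polynomials"
proof -
  obtain A a where "finite A" "P = (\<lambda>z. \<Sum>\<gamma>\<in>A. a \<gamma> * multi_power z \<gamma>)"
    using assms by (auto simp: complex_polynomials_def)
  then show ?thesis
    unfolding complex_polynomials_def
    by (auto intro!: exI[of _ A] exI[of _ "\<lambda>\<gamma>. c * a \<gamma>"] simp: sum_distrib_left mult.assoc)
qed

lemma polynomials_add:
  assumes "P \<in> complex_polynomials" "Q \<in> complex_polynomials"
  shows "(\<lambda>z. P z + Q z) \<in> complex_polynomials"
proof -
  obtain A a B b where A: "finite A" "P = (\<lambda>z. \<Sum>\<gamma>\<in>A. a \<gamma> * multi_power z \<gamma>)"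
    and B: "finite B" "Q = (\<lambda>z. \<Sum>\<gamma>\<in>B. b \<gamma> * multi_power z \<gamma>)"
    using assms unfolding complex_polynomials_def by blast
  \<comment> \<open>The index sets may overlap or differ, so both coefficient families are extended
    by 0 to the union.\<close>
  let ?c = "\<lambda>\<gamma>. (if \<gamma> \<in> A then a \<gamma> else 0) + (if \<gamma> \<in> B then b \<gamma> else 0)"
  have "P z = (\<Sum>\<gamma>\<in>A\<union>B. (if \<gamma> \<in> A then a \<gamma> else 0) * multi_power z \<gamma>)" for z
    unfolding A using A(1) B(1) by (intro sum.mono_neutral_cong_left) auto
  moreover have "Q z = (\<Sum>\<gamma>\<in>A\<union>B. (if \<gamma> \<in> B then b \<gamma> else 0) * multi_power z \<gamma>)" for z
    unfolding B using A(1) B(1) by (intro sum.mono_neutral_cong_left) auto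
  ultimately have "(\<lambda>z. P z + Q z) = (\<lambda>z. \<Sum>\<gamma>\<in>A\<union>B. ?c \<gamma> * multi_power z \<gamma>)"
    by (simp add: sum.distrib distrib_right)
  then show ?thesis
    using A(1) B(1) unfolding complex_polynomials_def
    by (auto intro!: exI[of _ "A \<union> B"] exI[of _ ?c])
qed

lemma multi_power_polynomial: "(\<lambda>z. multi_power z \<gamma>) \<in> complex_polynomials"
  unfolding complex_polynomials_def by (auto intro!: exI[of _ "{\<gamma>}"] exI[of _ "\<lambda>_. 1"])

lemma zero_polynomial: "(\<lambda>z. 0) \<in> complex_polynomials"
  unfolding complex_polynomials_def by (auto intro!: exI[of _ "{}"])

lemma polynomials_sum:
  "(\<And>i. i \<in> A \<Longrightarrow> P i \<in> complex_polynomials) \<Longrightarrow> (\<lambda>z. \<Sum>i\<in>A. P i z) \<in> complex_polynomials"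
  by (induction A rule: infinite_finite_induct) (auto intro: zero_polynomial polynomials_add)

lemma coordinate_power_polynomial:
  fixes l :: "'n::finite"
  shows "(\<lambda>z. (z $ l) ^ m) \<in> complex_polynomials"
proof -
  have "multi_power z (\<lambda>i. if i = l then m else 0) = (z $ l) ^ m" for z :: "complex ^ 'n"
    by (simp add: multi_power_def if_distrib[of "\<lambda>n. _ ^ n"] cong: if_cong)
  then show ?thesis
    using multi_power_polynomial[of "\<lambda>i. if i = l then m else 0"] by simp
qed

lemma bloch_density_zero: "bloch_density p (\<lambda>z. 0) z = 0"
  by (simp add: bloch_density_def partial_deriv_def)

lemma zero_bloch: "(\<lambda>z. 0) \<in> bloch p"
  by (rule blochI[where M = 0]) (auto simp: bloch_density_zero holomorphic_several_const)

lemma bloch_norm_zero: "bloch_norm p (\<lambda>z. 0) = 0"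
  using zero_in_polydisk by (auto simp: bloch_norm_def bloch_density_zero intro: cSUP_const)

lemma norm_partial_deriv_multi_power_le:
  fixes z :: "complex ^ 'n"
  assumes "z \<in> polydisk"
  shows "cmod (partial_deriv k (\<lambda>z. multi_power z \<gamma>) z) \<le> \<gamma> k"
proof -
  let ?R = "\<Prod>i\<in>UNIV - {k}. (z $ i) ^ \<gamma> i"
  have le: "cmod (z $ i) \<le> 1" for i
    using assms by (simp add: polydisk_def less_imp_le)
  have "multi_power (\<chi> i. if i = k then w else z $ i) \<gamma> = w ^ \<gamma> k * ?R" for w
    unfolding multi_power_def by (subst prod.remove[of UNIV k]) auto
  \<comment> \<open>For \<open>\<gamma> k = 0\<close> the truncated exponent
    \<open>\<gamma> k - 1\<close> is 0, which is harmless because the factor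
    \<open>\<gamma> k\<close> vanishes.\<close>
  moreover have "((\<lambda>w. w ^ \<gamma> k * ?R) has_field_derivative \<gamma> k * (z $ k) ^ (\<gamma> k - 1) * ?R) (at (z $ k))"
    by (auto intro!: derivative_eq_intros)
  ultimately have "partial_deriv k (\<lambda>z. multi_power z \<gamma>) z = \<gamma> k * (z $ k) ^ (\<gamma> k - 1) * ?R"
    unfolding partial_deriv_def by (simp add: DERIV_imp_deriv)
  moreover have "cmod ((z $ k) ^ (\<gamma> k - 1)) \<le> 1" "cmod ?R \<le> 1"
    using le by (auto simp: norm_power prod_norm[symmetric] intro!: power_le_one prod_le_1)
  then have "\<gamma> k * cmod ((z $ k) ^ (\<gamma> k - 1)) * cmod ?R \<le> real (\<gamma> k) * 1 * 1"
    by (intro mult_mono) auto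
  ultimately show ?thesis
    by (simp add: norm_mult)
qed

lemma multi_power_bloch:
  assumes "p > 0"
  shows "(\<lambda>z::complex ^ 'n. multi_power z \<gamma>) \<in> bloch p"
proof (rule blochI[where M = "\<Sum>k\<in>UNIV. real (\<gamma> k)"])
  fix z :: "complex ^ 'n" assume z: "z \<in> polydisk"
  have "cmod (partial_deriv k (\<lambda>z. multi_power z \<gamma>) z) * (1 - (cmod (z $ k))\<^sup>2) powr p
      \<le> real (\<gamma> k) * 1" for k
    using norm_partial_deriv_multi_power_le[OF z] polydisk_weight_powr_le_1[OF z assms]
    by (intro mult_mono) auto
  then show "bloch_density p (\<lambda>z. multi_power z \<gamma>) z \<le> (\<Sum>k\<in>UNIV. real (\<gamma> k))"
    unfolding bloch_density_def by (intro sum_mono) simp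
qed (rule holomorphic_several_multi_power)

lemma polynomial_bloch:
  fixes P :: "complex ^ 'n \<Rightarrow> complex"
  assumes "p > 0" "P \<in> complex_polynomials"
  shows "P \<in> bloch p"
proof -
  have "(\<lambda>z. \<Sum>\<gamma>\<in>A. a \<gamma> * multi_power z \<gamma>) \<in> bloch p" for A and a :: "('n \<Rightarrow> nat) \<Rightarrow> complex"
    by (induction A rule: infinite_finite_induct)
       (simp_all add: zero_bloch bloch_add bloch_scale multi_power_bloch[OF \<open>p > 0\<close>])
  then show ?thesis
    using assms(2) by (auto simp: complex_polynomials_def)
qed

section \<open>The little Bloch space as a closed subspace\<close>

lemma little_bloch_subset: "f \<in> little_bloch p \<Longrightarrow> f \<in> bloch p"
  by (simp add: little_bloch_def)

lemma polynomial_little_bloch: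
  fixes P :: "complex ^ 'n \<Rightarrow> complex"
  assumes "p > 0" "P \<in> complex_polynomials"
  shows "P \<in> little_bloch p"
  unfolding little_bloch_def using assms polynomial_bloch[OF assms]
  by (auto intro!: bexI[of _ P] simp: bloch_norm_zero)

text \<open>The closure of the polynomials is closed: half of \<open>\<epsilon>\<close> is spent
  from \<open>f\<close> to \<open>g\<close>, half from \<open>g\<close> to a polynomial. It allows
  approximation by functions such as \<open>P\<close> composed with \<phi>, which need not be
  polynomials.\<close>

lemma little_bloch_closed:
  fixes f :: "complex ^ 'n \<Rightarrow> complex"
  assumes "p > 0" "f \<in> bloch p"
    and approx: "\<And>\<epsilon>. \<epsilon> > 0 \<Longrightarrow> \<exists>g\<in>little_bloch p. bloch_norm p (\<lambda>z. f z - g z) < \<epsilon>"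
  shows "f \<in> little_bloch p"
proof -
  have "\<exists>P\<in>complex_polynomials. bloch_norm p (\<lambda>z. f z - P z) < \<epsilon>" if "\<epsilon> > 0" for \<epsilon>
  proof -
    have "\<epsilon> / 2 > 0"
      using that by simp
    then obtain g where g: "g \<in> little_bloch p" "bloch_norm p (\<lambda>z. f z - g z) < \<epsilon> / 2"
      using approx by blast
    then obtain P where P: "P \<in> complex_polynomials" "bloch_norm p (\<lambda>z. g z - P z) < \<epsilon> / 2"
      using \<open>\<epsilon> / 2 > 0\<close> unfolding little_bloch_def by blast
    have "bloch_norm p (\<lambda>z. (f z - g z) + (g z - P z)) < \<epsilon> / 2 + \<epsilon> / 2"
      using g P bloch_norm_add[OF bloch_diff[OF assms(2)] bloch_diff, of g g P]
        little_bloch_subset[of g p] polynomial_bloch[OF assms(1), of P] by fastforce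
    with P(1) show ?thesis
      by auto
  qed
  with assms(2) show ?thesis
    by (simp add: little_bloch_def)
qed

lemma little_bloch_add:
  fixes f g :: "complex ^ 'n \<Rightarrow> complex"
  assumes "p > 0" "f \<in> little_bloch p" "g \<in> little_bloch p"
  shows "(\<lambda>z. f z + g z) \<in> little_bloch p"
proof -
  have fg: "f \<in> bloch p" "g \<in> bloch p"
    using assms by (auto intro: little_bloch_subset)
  have "\<exists>P\<in>complex_polynomials. bloch_norm p (\<lambda>z. (f z + g z) - P z) < \<epsilon>" if "\<epsilon> > 0" for \<epsilon>
  proof -
    have "\<epsilon> / 2 > 0"
      using that by simp
    with assms obtain P Q where P: "P \<in> complex_polynomials" "bloch_norm p (\<lambda>z. f z - P z) < \<epsilon> / 2"
      and Q: "Q \<in> complex_polynomials" "bloch_norm p (\<lambda>z. g z - Q z) < \<epsilon> / 2"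
      unfolding little_bloch_def by blast
    have "bloch_norm p (\<lambda>z. (f z - P z) + (g z - Q z)) < \<epsilon>"
      using P Q bloch_norm_add[OF bloch_diff bloch_diff, OF fg(1) _ fg(2), of P Q]
        polynomial_bloch[OF assms(1)] by fastforce
    then show ?thesis
      using polynomials_add[OF P(1) Q(1)] by (intro bexI[of _ "\<lambda>z. P z + Q z"]) (auto simp: algebra_simps)
  qed
  with bloch_add[OF fg] show ?thesis
    by (simp add: little_bloch_def)
qed

lemma little_bloch_scale:
  fixes f :: "complex ^ 'n \<Rightarrow> complex"
  assumes "p > 0" "f \<in> little_bloch p"
  shows "(\<lambda>z. c * f z) \<in> little_bloch p"
proof -
  have f: "f \<in> bloch p"
    using assms by (auto intro: little_bloch_subset)
  have "\<exists>P\<in>complex_polynomials. bloch_norm p (\<lambda>z. c * f z - P z) < \<epsilon>" if "\<epsilon> > 0" for \<epsilon>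
  proof -
    \<comment> \<open>Dividing by \<open>cmod c + 1\<close> instead of \<open>cmod c\<close> also
      covers \<open>c = 0\<close>.\<close>
    have pos: "cmod c + 1 > 0"
      by (simp add: add_nonneg_pos)
    with that have "\<epsilon> / (cmod c + 1) > 0"
      by simp
    with assms obtain P where P: "P \<in> complex_polynomials"
      "bloch_norm p (\<lambda>z. f z - P z) < \<epsilon> / (cmod c + 1)"
      unfolding little_bloch_def by blast
    have fP: "(\<lambda>z. f z - P z) \<in> bloch p"
      using f polynomial_bloch[OF assms(1) P(1)] by (rule bloch_diff)
    have "bloch_norm p (\<lambda>z. c * (f z - P z)) \<le> cmod c * bloch_norm p (\<lambda>z. f z - P z)"
      by (rule bloch_norm_scale[OF fP])
    also have "\<dots> \<le> cmod c * (\<epsilon> / (cmod c + 1))"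
      using P(2) by (intro mult_left_mono) auto
    also have "\<dots> < \<epsilon>"
      using pos that by (simp add: field_simps)
    finally show ?thesis
      using polynomials_scale[OF P(1)] by (intro bexI[of _ "\<lambda>z. c * P z"]) (auto simp: algebra_simps)
  qed
  with bloch_scale[OF f] show ?thesis
    by (simp add: little_bloch_def)
qed

lemma little_bloch_sum:
  fixes f :: "'i \<Rightarrow> complex ^ 'n \<Rightarrow> complex"
  assumes "p > 0"
  shows "(\<And>i. i \<in> A \<Longrightarrow> f i \<in> little_bloch p) \<Longrightarrow> (\<lambda>z. \<Sum>i\<in>A. f i z) \<in> little_bloch p"
  by (induction A rule: infinite_finite_induct)
     (auto intro: little_bloch_add[OF assms] polynomial_little_bloch[OF assms zero_polynomial])

subsection \<open>Boundedness of the composition operator\<close>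

text \<open>Along the segment from 0 to \<open>w\<close> each coordinate has modulus at most that of
  \<open>w $ l\<close>, so the weights are bounded below by those at \<open>w\<close> and the
  partial derivatives by the norm over these weights. The constant depends on \<open>w\<close>,
  which suffices because the bound is applied only at \<open>\<phi> 0\<close>.\<close>

lemma bloch_growth:
  fixes f :: "complex ^ 'n \<Rightarrow> complex"
  assumes "p > 0" "f \<in> bloch p" "w \<in> polydisk"
  shows "cmod (f w) \<le> (1 + (\<Sum>l\<in>UNIV. 1 / (1 - (cmod (w $ l))\<^sup>2) powr p)) * bloch_norm p f"
proof -
  define N where "N = bloch_norm p f"
  define B where "B = (\<Sum>l\<in>UNIV. N / (1 - (cmod (w $ l))\<^sup>2) powr p)"
  \<comment> \<open>The parameter \<open>s\<close> ranges over the closed complex disk, a convex set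
    containing 0 and 1, so that the mean value inequality for complex derivatives applies.\<close>
  have in_polydisk: "s *s w \<in> polydisk" and le: "cmod (s * w $ l) \<le> cmod (w $ l)"
    if "s \<in> cball 0 1" for s l
  proof -
    have le: "cmod (s * w $ l) \<le> cmod (w $ l)" for l
      using that by (simp add: norm_mult mult_left_le_one_le)
    then show "cmod (s * w $ l) \<le> cmod (w $ l)" .
    show "s *s w \<in> polydisk"
      using assms(3) le le_less_trans by (auto simp: polydisk_def) blast
  qed
  have deriv: "((\<lambda>s. f (s *s w)) has_field_derivative (\<Sum>l\<in>UNIV. partial_deriv l f (s *s w) * w $ l))
      (at s within cball 0 1)" if "s \<in> cball 0 1" for s
  proof -
    have "((\<lambda>s. s *s w) has_derivative (\<lambda>h. h *s w)) (at s)"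
      by (rule has_derivative_vecI) (auto intro!: derivative_eq_intros)
    moreover have "(f has_derivative (\<lambda>v. \<Sum>l\<in>UNIV. partial_deriv l f (s *s w) * v $ l)) (at (s *s w))"
      using assms(2) in_polydisk[OF that] unfolding bloch_def holomorphic_several_iff by blast
    ultimately have "((\<lambda>s. f (s *s w)) has_derivative
        (\<lambda>h. \<Sum>l\<in>UNIV. partial_deriv l f (s *s w) * (h * w $ l))) (at s)"
      using diff_chain_at by (fastforce simp: o_def)
    moreover have "(\<lambda>h. \<Sum>l\<in>UNIV. partial_deriv l f (s *s w) * (h * w $ l)) =
        (*) (\<Sum>l\<in>UNIV. partial_deriv l f (s *s w) * w $ l)"
      by (auto simp: sum_distrib_left mult_ac)
    ultimately have "((\<lambda>s. f (s *s w)) has_field_derivative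
        (\<Sum>l\<in>UNIV. partial_deriv l f (s *s w) * w $ l)) (at s)"
      by (simp add: has_field_derivative_def)
    then show ?thesis
      by (rule has_field_derivative_at_within)
  qed
  have bound: "cmod (\<Sum>l\<in>UNIV. partial_deriv l f (s *s w) * w $ l) \<le> B" if "s \<in> cball 0 1" for s
  proof -
    have "cmod (partial_deriv l f (s *s w) * w $ l) \<le> N / (1 - (cmod (w $ l))\<^sup>2) powr p" for l
    proof -
      have w: "0 < 1 - (cmod (w $ l))\<^sup>2"
        using assms(3) by (rule polydisk_weight)
      have "cmod (partial_deriv l f (s *s w)) * (1 - (cmod (w $ l))\<^sup>2) powr p
          \<le> cmod (partial_deriv l f (s *s w)) * (1 - (cmod ((s *s w) $ l))\<^sup>2) powr p"
        using le[OF that, of l] w assms(1)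
        by (intro mult_left_mono powr_mono2) (auto intro!: power_mono)
      also have "\<dots> \<le> bloch_density p f (s *s w)"
        by (rule bloch_density_ge_term)
      also have "\<dots> \<le> N"
        using bloch_norm_ge[OF assms(2) in_polydisk[OF that]] norm_ge_zero[of "f 0"]
        unfolding N_def by linarith
      finally have "cmod (partial_deriv l f (s *s w)) \<le> N / (1 - (cmod (w $ l))\<^sup>2) powr p"
        using w by (simp add: field_simps)
      moreover have "cmod (w $ l) \<le> 1"
        using assms(3) by (simp add: polydisk_def less_imp_le)
      then have "cmod (partial_deriv l f (s *s w) * w $ l) \<le> cmod (partial_deriv l f (s *s w))"
        by (simp add: norm_mult mult_left_le)
      ultimately show ?thesis
        by linarith
    qed
    then show ?thesis
      unfolding B_def by (rule sum_norm_le)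
  qed
  have "cmod (f (1 *s w) - f (0 *s w)) \<le> B * cmod (1 - 0)"
    by (rule field_differentiable_bound[OF convex_cball[of 0 1] deriv bound]) auto
  then have "cmod (f w - f 0) \<le> B"
    by simp
  moreover have "bloch_density p f 0 \<ge> 0"
    unfolding bloch_density_def by (intro sum_nonneg) auto
  then have "cmod (f 0) \<le> N"
    using bloch_norm_ge[OF assms(2) zero_in_polydisk] unfolding N_def by linarith
  moreover have "B = (\<Sum>l\<in>UNIV. 1 / (1 - (cmod (w $ l))\<^sup>2) powr p) * N"
    unfolding B_def by (simp add: sum_distrib_right)
  ultimately show ?thesis
    using norm_triangle_sub[of "f w" "f 0"] unfolding N_def by (simp add: distrib_right)
qed

text \<open>In the chain rule each factor \<open>partial_deriv l f (\<phi> z)\<close> costs at most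
  the norm of \<open>f\<close> over the weight at \<open>\<phi> z $ l\<close>, which leaves exactly
  the sum bounded by \<open>C\<close>. The same \<open>K\<close> serves for every \<open>f\<close>,
  so it can be applied to differences \<open>f - P\<close> in the density argument.\<close>

lemma composition_bloch_bounded:
  fixes \<phi> :: "complex ^ 'n \<Rightarrow> complex ^ 'n"
  assumes \<phi>: "holomorphic_self_map \<phi>" and "p > 0"
    and C: "\<And>z. z \<in> polydisk \<Longrightarrow>
      (\<Sum>k\<in>UNIV. \<Sum>l\<in>UNIV. cmod (partial_deriv k (\<lambda>w. \<phi> w $ l) z) *
        ((1 - (cmod (z $ k))\<^sup>2) powr q / (1 - (cmod (\<phi> z $ l))\<^sup>2) powr p)) \<le> C"
  obtains K where "K \<ge> 0" "\<And>f. f \<in> bloch p \<Longrightarrow> (\<lambda>z. f (\<phi> z)) \<in> bloch q"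
    "\<And>f. f \<in> bloch p \<Longrightarrow> bloch_norm q (\<lambda>z. f (\<phi> z)) \<le> K * bloch_norm p f"
proof -
  have hol: "\<And>l. holomorphic_several (\<lambda>z. \<phi> z $ l) polydisk" and img: "\<phi> ` polydisk \<subseteq> polydisk"
    using \<phi> by (auto simp: holomorphic_self_map_def)
  have C0: "C \<ge> 0"
    using zero_in_polydisk by (intro order_trans[OF _ C]) (auto intro!: sum_nonneg)
  have dens: "bloch_density q (\<lambda>z. f (\<phi> z)) z \<le> C * bloch_norm p f"
    if f: "f \<in> bloch p" and z: "z \<in> polydisk" for f z
  proof -
    let ?N = "bloch_norm p f"
    let ?b = "\<lambda>k l. cmod (partial_deriv k (\<lambda>w. \<phi> w $ l) z) *
        ((1 - (cmod (z $ k))\<^sup>2) powr q / (1 - (cmod (\<phi> z $ l))\<^sup>2) powr p)"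
    have \<phi>z: "\<phi> z \<in> polydisk"
      using img z by auto
    have fhol: "holomorphic_several f polydisk"
      using f by (simp add: bloch_def)
    have N0: "?N \<ge> 0"
      by (rule bloch_norm_nonneg[OF f])
    have le: "cmod (partial_deriv l f (\<phi> z)) * (1 - (cmod (\<phi> z $ l))\<^sup>2) powr p \<le> ?N" for l
      using bloch_norm_ge[OF f \<phi>z] bloch_density_ge_term[of l f "\<phi> z" p] norm_ge_zero[of "f 0"]
      by linarith
    have "bloch_density q (\<lambda>z. f (\<phi> z)) z \<le> (\<Sum>k\<in>UNIV. \<Sum>l\<in>UNIV. ?N * ?b k l)"
      unfolding bloch_density_def
    proof (rule sum_mono)
      fix k
      have "cmod (partial_deriv k (\<lambda>z. f (\<phi> z)) z) * (1 - (cmod (z $ k))\<^sup>2) powr q \<le>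
          (\<Sum>l\<in>UNIV. cmod (partial_deriv l f (\<phi> z)) * cmod (partial_deriv k (\<lambda>z. \<phi> z $ l) z)) *
            (1 - (cmod (z $ k))\<^sup>2) powr q"
        unfolding partial_deriv_compose[OF fhol hol img z]
        by (intro mult_right_mono sum_norm_le) (auto simp: norm_mult)
      \<comment> \<open>Each summand is multiplied and divided by the weight at
        \<open>\<phi> z\<close>, which is positive because \<open>\<phi> z\<close> lies in the
        polydisk.\<close>
      also have "\<dots> = (\<Sum>l\<in>UNIV. cmod (partial_deriv l f (\<phi> z)) * (1 - (cmod (\<phi> z $ l))\<^sup>2) powr p * ?b k l)"
        unfolding sum_distrib_right
      proof (rule sum.cong[OF refl])
        fix l
        have "(1 - (cmod (\<phi> z $ l))\<^sup>2) powr p \<noteq> 0"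
          using polydisk_weight(1)[OF \<phi>z, of l] by simp
        then show "cmod (partial_deriv l f (\<phi> z)) * cmod (partial_deriv k (\<lambda>z. \<phi> z $ l) z) *
            (1 - (cmod (z $ k))\<^sup>2) powr q =
          cmod (partial_deriv l f (\<phi> z)) * (1 - (cmod (\<phi> z $ l))\<^sup>2) powr p * ?b k l"
          by simp
      qed
      also have "\<dots> \<le> (\<Sum>l\<in>UNIV. ?N * ?b k l)"
        by (intro sum_mono mult_right_mono le) auto
      finally show "cmod (partial_deriv k (\<lambda>z. f (\<phi> z)) z) * (1 - (cmod (z $ k))\<^sup>2) powr q
        \<le> (\<Sum>l\<in>UNIV. ?N * ?b k l)" .
    qed
    also have "\<dots> = ?N * (\<Sum>k\<in>UNIV. \<Sum>l\<in>UNIV. ?b k l)"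
      by (simp only: sum_distrib_left)
    also have "\<dots> \<le> ?N * C"
      by (rule mult_left_mono[OF C[OF z] N0])
    finally show ?thesis
      by (simp add: mult.commute)
  qed
  \<comment> \<open>The growth constant at \<open>\<phi> 0\<close>: it bounds the value of the
    composition at 0, while \<open>C\<close> bounds its density.\<close>
  define G where "G = 1 + (\<Sum>l\<in>UNIV. 1 / (1 - (cmod (\<phi> 0 $ l))\<^sup>2) powr p)"
  have "G \<ge> 0"
    unfolding G_def by (intro add_nonneg_nonneg sum_nonneg) auto
  show thesis
  proof
    show "G + C \<ge> 0"
      using \<open>G \<ge> 0\<close> C0 by simp
    fix f :: "complex ^ 'n \<Rightarrow> complex" assume f: "f \<in> bloch p"
    then have "holomorphic_several f polydisk"
      by (simp add: bloch_def)
    from holomorphic_several_compose[OF this hol img] dens[OF f]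
    show "(\<lambda>z. f (\<phi> z)) \<in> bloch q"
      by (rule blochI)
    have "cmod (f (\<phi> 0)) \<le> G * bloch_norm p f"
      unfolding G_def using img zero_in_polydisk by (intro bloch_growth assms(2) f) auto
    with bloch_norm_le[of q "\<lambda>z. f (\<phi> z)", OF dens[OF f]]
    show "bloch_norm q (\<lambda>z. f (\<phi> z)) \<le> (G + C) * bloch_norm p f"
      by (simp add: distrib_right)
  qed
qed

subsection \<open>Test functions\<close>

text \<open>The coefficient \<open>c (Suc n)\<close> occurs in \<open>diffs c n\<close> with the
  factor \<open>Suc n\<close>, so it is dominated. The factor \<open>1 ^ n\<close> presents the
  result as convergence at the point 1, from which convergence and termwise differentiation in the
  open disk follow.\<close>

lemma summable_of_summable_diffs:
  fixes c :: "nat \<Rightarrow> complex"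
  assumes "summable (\<lambda>n. cmod (diffs c n))"
  shows "summable (\<lambda>n. c n * 1 ^ n)"
proof -
  have "summable (\<lambda>n. c (Suc n) * 1 ^ Suc n)"
  proof (rule summable_comparison_test[OF exI[of _ 0] assms], intro allI impI)
    fix n
    have "1 * cmod (c (Suc n)) \<le> real (Suc n) * cmod (c (Suc n))"
      by (intro mult_right_mono) auto
    then show "norm (c (Suc n) * 1 ^ Suc n) \<le> cmod (diffs c n)"
      by (simp add: diffs_def norm_mult del: of_nat_Suc)
  qed
  then show ?thesis
    using summable_Suc_iff[of "\<lambda>n. c n * 1 ^ n"] by blast
qed

text \<open>Termwise differentiation inside the disk, followed by the projection to the
  \<open>l\<close>-th coordinate, leaves only the \<open>l\<close>-th partial derivative.\<close>

lemma
  fixes c :: "nat \<Rightarrow> complex" and l :: "'n::finite"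
  assumes summable: "summable (\<lambda>n. cmod (diffs c n))"
  shows holomorphic_several_power_series:
      "holomorphic_several (\<lambda>z. \<Sum>n. c n * (z $ l) ^ n) polydisk" (is "holomorphic_several ?f _")
    and partial_deriv_power_series: "z \<in> polydisk \<Longrightarrow>
      partial_deriv k (\<lambda>z. \<Sum>n. c n * (z $ l) ^ n) z =
        (if k = l then \<Sum>n. diffs c n * (z $ l) ^ n else 0)"
proof -
  note sum1 = summable_of_summable_diffs[OF summable]
  have D: "(?f has_derivative (\<lambda>v. \<Sum>k\<in>UNIV. (if k = l then \<Sum>n. diffs c n * (z $ l) ^ n else 0) * v $ k)) (at z)"
    if "z \<in> polydisk" for z
  proof -
    have "((\<lambda>x. \<Sum>n. c n * x ^ n) has_field_derivative (\<Sum>n. diffs c n * (z $ l) ^ n)) (at (z $ l))"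
      using that by (intro termdiffs_strong[OF sum1]) (simp add: polydisk_def)
    moreover have "((\<lambda>z. z $ l) has_derivative (\<lambda>v. v $ l)) (at z)"
      by (auto intro: bounded_linear_imp_has_derivative)
    ultimately have "(?f has_derivative (\<lambda>v. (\<Sum>n. diffs c n * (z $ l) ^ n) * v $ l)) (at z)"
      unfolding has_field_derivative_def by (auto dest!: diff_chain_at simp: o_def)
    then show ?thesis
      by (simp add: if_distrib[of "\<lambda>x. x * _"] cong: if_cong)
  qed
  show "holomorphic_several ?f polydisk"
    using D by (rule holomorphic_severalI)
  show "z \<in> polydisk \<Longrightarrow> partial_deriv k ?f z = (if k = l then \<Sum>n. diffs c n * (z $ l) ^ n else 0)"
    by (rule partial_deriv_eqI[OF D])
qed

text \<open>On the polydisk the weight and the powers of \<open>z $ l\<close> have modulus at most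
  1, so the coefficients of the derivative control the norm. Applied to a tail of the series, this
  estimate gives approximation by partial sums.\<close>

lemma
  fixes c :: "nat \<Rightarrow> complex" and l :: "'n::finite"
  assumes "p > 0" and summable: "summable (\<lambda>n. cmod (diffs c n))"
  shows power_series_bloch: "(\<lambda>z. \<Sum>n. c n * (z $ l) ^ n) \<in> bloch p"
    and bloch_norm_power_series:
      "bloch_norm p (\<lambda>z. \<Sum>n. c n * (z $ l) ^ n) \<le> cmod (c 0) + (\<Sum>n. cmod (diffs c n))"
proof -
  let ?f = "\<lambda>z::complex ^ 'n. \<Sum>n. c n * (z $ l) ^ n"
  have dens: "bloch_density p ?f z \<le> (\<Sum>n. cmod (diffs c n))" if z: "z \<in> polydisk" for z
  proof -
    have le: "cmod (diffs c n * (z $ l) ^ n) \<le> cmod (diffs c n)" for n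
      using z by (simp add: norm_mult norm_power polydisk_def less_imp_le power_le_one mult_left_le)
    have "bloch_density p ?f z = cmod (\<Sum>n. diffs c n * (z $ l) ^ n) * (1 - (cmod (z $ l))\<^sup>2) powr p"
      unfolding bloch_density_def partial_deriv_power_series[OF summable z]
      by (simp add: if_distrib[of cmod] if_distrib[of "\<lambda>x. x * _"] cong: if_cong)
    also have "\<dots> \<le> cmod (\<Sum>n. diffs c n * (z $ l) ^ n)"
      using polydisk_weight_powr_le_1[OF z assms(1)] by (simp add: mult_left_le)
    also have "\<dots> \<le> (\<Sum>n. cmod (diffs c n))"
      using le summable by (rule norm_suminf_le)
    finally show ?thesis .
  qed
  show "?f \<in> bloch p"
    using holomorphic_several_power_series[OF summable] dens by (rule blochI)
  have "?f 0 = c 0"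
    using suminf_finite[of "{0}" "\<lambda>n. c n * 0 ^ n"] by simp
  then show "bloch_norm p ?f \<le> cmod (c 0) + (\<Sum>n. cmod (diffs c n))"
    using bloch_norm_le[of p ?f, OF dens] by simp
qed

lemma power_series_little_bloch:
  fixes c :: "nat \<Rightarrow> complex" and l :: "'n::finite"
  assumes "p > 0" and summable: "summable (\<lambda>n. cmod (diffs c n))"
  shows "(\<lambda>z. \<Sum>n. c n * (z $ l) ^ n) \<in> little_bloch p"
proof (rule little_bloch_closed[OF assms(1) power_series_bloch[OF assms]])
  let ?f = "\<lambda>c (z::complex ^ 'n). \<Sum>n. c n * (z $ l) ^ n"
  fix \<epsilon> :: real assume "\<epsilon> > 0"
  then obtain N where N: "norm (\<Sum>n. cmod (diffs c (n + N))) < \<epsilon>"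
    using suminf_exist_split[OF _ summable] by blast
  \<comment> \<open>The cut keeps the index \<open>N\<close> in \<open>d\<close>: since
    \<open>diffs\<close> shifts indices by one, \<open>diffs e\<close> then vanishes exactly below
    \<open>N\<close> and continues with the tail chosen above.\<close>
  define d where "d = (\<lambda>n. if n \<le> N then c n else 0)"
  define e where "e = (\<lambda>n. if n \<le> N then 0 else c n)"
  have diffs_e: "diffs e n = (if n < N then 0 else diffs c n)" for n
    by (auto simp: diffs_def e_def)
  have sum_e: "summable (\<lambda>n. cmod (diffs e n))"
    by (rule summable_comparison_test[OF exI[of _ 0] summable]) (auto simp: diffs_e)
  have "(\<Sum>n. cmod (diffs e n)) = (\<Sum>n. cmod (diffs e (n + N))) + (\<Sum>n<N. cmod (diffs e n))"
    using sum_e by (rule suminf_split_initial_segment)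
  also have "\<dots> < \<epsilon>"
    using N by (simp add: diffs_e)
  finally have "cmod (e 0) + (\<Sum>n. cmod (diffs e n)) < \<epsilon>"
    by (simp add: e_def)
  then have small: "bloch_norm p (?f e) < \<epsilon>"
    using bloch_norm_power_series[OF assms(1) sum_e, of l] by linarith
  have d_eq: "?f d z = (\<Sum>n\<le>N. c n * (z $ l) ^ n)" for z
    by (subst suminf_finite[of "{..N}"]) (auto simp: d_def)
  \<comment> \<open>Only on the polydisk: outside it \<open>\<Sum>\<close> may be a junk value.\<close>
  have e_eq: "?f e z = ?f c z - ?f d z" if "z \<in> polydisk" for z
  proof -
    have "summable (\<lambda>n. c n * (z $ l) ^ n)"
      using that by (intro powser_inside[OF summable_of_summable_diffs[OF summable]])
        (simp add: polydisk_def)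
    moreover have "summable (\<lambda>n. d n * (z $ l) ^ n)"
      by (rule summable_finite[of "{..N}"]) (auto simp: d_def)
    ultimately have "?f c z - ?f d z = (\<Sum>n. c n * (z $ l) ^ n - d n * (z $ l) ^ n)"
      by (rule suminf_diff)
    moreover have "c n * (z $ l) ^ n - d n * (z $ l) ^ n = e n * (z $ l) ^ n" for n
      by (simp add: d_def e_def)
    ultimately show ?thesis
      by simp
  qed
  have "?f d \<in> complex_polynomials"
    unfolding d_eq by (intro polynomials_sum polynomials_scale coordinate_power_polynomial)
  then have "?f d \<in> little_bloch p"
    by (rule polynomial_little_bloch[OF assms(1)])
  moreover have "bloch_norm p (\<lambda>z. ?f c z - ?f d z) < \<epsilon>"
    using small bloch_norm_cong[OF holomorphic_several_power_series[OF sum_e] e_eq] by simp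
  ultimately show "\<exists>g\<in>little_bloch p. bloch_norm p (\<lambda>z. ?f c z - g z) < \<epsilon>"
    by (intro bexI[of _ "?f d"])
qed

text \<open>The bound \<open>2 powr p\<close> does not depend on \<open>a\<close>, which makes the
  constant obtained for (b) uniform in \<open>z\<close>. At the coordinate value \<open>a\<close>
  the derivative has exactly the size of the reciprocal weight.\<close>

lemma test_function:
  fixes l :: "'n::finite"
  assumes "p > 0" and a: "cmod a < 1"
  obtains f :: "complex ^ 'n \<Rightarrow> complex" where "f \<in> little_bloch p" "bloch_norm p f \<le> 2 powr p"
    "\<And>w k. w \<in> polydisk \<Longrightarrow> w $ l = a \<Longrightarrow>
      cmod (partial_deriv k f w) = (if k = l then 1 / (1 - (cmod a)\<^sup>2) powr p else 0)"
proof -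
  \<comment> \<open>\<open>b\<close> holds the binomial coefficients of
    \<open>(1 - cnj a * t) powr (- p)\<close> as a series in \<open>t\<close>; \<open>c\<close> is
    its termwise primitive, with constant term 0 so that the test function vanishes at 0.\<close>
  define b where "b = (\<lambda>n. ((- of_real p) gchoose n) * (- cnj a) ^ n :: complex)"
  define c where "c = (\<lambda>n. case n of 0 \<Rightarrow> 0 | Suc m \<Rightarrow> b m / of_nat (Suc m))"
  have diffs_c: "diffs c = b"
    by (rule ext) (simp add: diffs_def c_def del: of_nat_Suc)
  have c0: "c 0 = 0"
    by (simp add: c_def)
  have summable: "summable (\<lambda>n. cmod (diffs c n))"
  proof -
    \<comment> \<open>The binomial series converges at a radius \<open>r\<close> strictly between
      \<open>cmod a\<close> and 1, hence absolutely at \<open>- cnj a\<close>; this is absolute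
      convergence of the series in \<open>t\<close> at \<open>t = 1\<close>.\<close>
    obtain r where r: "cmod a < r" "r < 1"
      using a dense by blast
    then have "norm (of_real r :: complex) = r"
      using norm_ge_zero[of a] by (simp del: norm_ge_zero)
    then have "summable (\<lambda>n. ((- of_real p) gchoose n) * (of_real r :: complex) ^ n)"
      using r gen_binomial_complex[of "of_real r"] by (auto intro: sums_summable)
    from powser_insidea[OF this, of "- cnj a"] r \<open>norm (of_real r :: complex) = r\<close>
    show ?thesis
      by (simp add: diffs_c b_def)
  qed
  have sum_b: "(\<Sum>n. b n * t ^ n) = (1 - cnj a * t) powr (- of_real p)" if "cmod t < 1" for t
  proof -
    have "cmod a * cmod t \<le> 1 * cmod t"
      using a by (intro mult_right_mono) auto
    then have "cmod (- cnj a * t) < 1"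
      using that by (simp add: norm_mult)
    from sums_unique[OF gen_binomial_complex[OF this, of "- of_real p"]] show ?thesis
      by (simp add: b_def power_mult_distrib[symmetric] mult.assoc)
  qed
  let ?f = "\<lambda>z::complex ^ 'n. \<Sum>n. c n * (z $ l) ^ n"
  \<comment> \<open>For a real exponent the modulus of the complex power is the real power of the
    modulus.\<close>
  have deriv: "cmod (partial_deriv k ?f z) =
      (if k = l then cmod (1 - cnj a * z $ l) powr - p else 0)" if "z \<in> polydisk" for z k
    using that sum_b[of "z $ l"] norm_powr_real_powr'[of "- of_real p" "1 - cnj a * z $ l"]
    unfolding partial_deriv_power_series[OF summable that] by (auto simp: diffs_c polydisk_def)
  have dens: "bloch_density p ?f z \<le> 2 powr p" if z: "z \<in> polydisk" for z
  proof -
    let ?t = "cmod (z $ l)"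
    have t: "0 \<le> ?t" "?t < 1"
      using z by (auto simp: polydisk_def)
    have "cmod a * ?t \<le> 1 * ?t"
      using a by (intro mult_right_mono) auto
    then have le: "1 - ?t \<le> cmod (1 - cnj a * z $ l)"
      using norm_triangle_ineq2[of 1 "cnj a * z $ l"] by (simp add: norm_mult)
    have "bloch_density p ?f z = cmod (1 - cnj a * z $ l) powr - p * (1 - ?t\<^sup>2) powr p"
      unfolding bloch_density_def deriv[OF z]
      by (simp add: if_distrib[of "\<lambda>x. x * _"] cong: if_cong)
    \<comment> \<open>The exponent is negative, so the lower bound for the modulus turns into an
      upper bound. Factoring \<open>1 - ?t\<^sup>2\<close> then cancels the singular factor and
      leaves \<open>1 + ?t\<close>, which is below 2.\<close>
    also have "\<dots> \<le> (1 - ?t) powr - p * (1 - ?t\<^sup>2) powr p"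
      using le t assms(1) by (intro mult_right_mono powr_mono2') auto
    also have "1 - ?t\<^sup>2 = (1 - ?t) * (1 + ?t)"
      by (simp add: power2_eq_square algebra_simps)
    also have "(1 - ?t) powr - p * ((1 - ?t) * (1 + ?t)) powr p = (1 + ?t) powr p"
      using t by (simp add: powr_mult powr_minus)
    also have "\<dots> \<le> 2 powr p"
      using t assms(1) by (intro powr_mono2) auto
    finally show ?thesis .
  qed
  show thesis
  proof
    show "?f \<in> little_bloch p"
      by (rule power_series_little_bloch[OF assms(1) summable])
    have "?f 0 = 0"
      using suminf_finite[of "{0}" "\<lambda>n. c n * 0 ^ n"] by (simp add: c0)
    with bloch_norm_le[of p ?f, OF dens] show "bloch_norm p ?f \<le> 2 powr p"
      by simp
  next
    fix w :: "complex ^ 'n" and k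
    assume w: "w \<in> polydisk" "w $ l = a"
    have "cnj a * a = of_real ((cmod a)\<^sup>2)"
      using complex_norm_square[of a] by (simp add: mult.commute)
    then have "cmod (1 - cnj a * a) = \<bar>1 - (cmod a)\<^sup>2\<bar>"
      by (metis norm_of_real of_real_1 of_real_diff)
    moreover have "1 - (cmod a)\<^sup>2 > 0"
      using a by (simp add: abs_square_less_1)
    ultimately show "cmod (partial_deriv k ?f w) =
        (if k = l then 1 / (1 - (cmod a)\<^sup>2) powr p else 0)"
      using deriv[OF w(1), of k] w(2) by (simp add: powr_minus_divide)
  qed
qed

section \<open>Necessity through test functions, sufficiency through density of the
  polynomials\<close>

theorem theorem6p1:
  fixes \<phi> :: "complex ^ 'n \<Rightarrow> complex ^ 'n" and p q :: real
  assumes "holomorphic_self_map \<phi>" and "p > 0" and "q > 0"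
  shows "bounded_operator (composition_operator \<phi>)
           (little_bloch p) (bloch_norm p) (little_bloch q) (bloch_norm q) \<longleftrightarrow>
         (\<forall>\<gamma> :: 'n \<Rightarrow> nat. (\<lambda>z. multi_power (\<phi> z) \<gamma>) \<in> little_bloch q) \<and>
         (\<exists>C :: real. \<forall>z\<in>polydisk.
            (\<Sum>k\<in>UNIV. \<Sum>l\<in>UNIV. cmod (partial_deriv k (\<lambda>w. \<phi> w $ l) z) *
               ((1 - (cmod (z $ k))\<^sup>2) powr q / (1 - (cmod (\<phi> z $ l))\<^sup>2) powr p)) \<le> C)"
    (is "?bounded \<longleftrightarrow> ?monomials \<and> (\<exists>C. \<forall>z\<in>polydisk. ?S z \<le> C)")
proof
  have hol: "\<And>l. holomorphic_several (\<lambda>z. \<phi> z $ l) polydisk" and img: "\<phi> ` polydisk \<subseteq> polydisk"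
    using assms(1) by (auto simp: holomorphic_self_map_def)
  assume ?bounded
  then have maps: "(\<lambda>z. f (\<phi> z)) \<in> little_bloch q" if "f \<in> little_bloch p" for f
    using that by (auto simp: bounded_operator_def composition_operator_def o_def)
  obtain K where K: "bloch_norm q (\<lambda>z. f (\<phi> z)) \<le> K * bloch_norm p f" if "f \<in> little_bloch p" for f
    using \<open>?bounded\<close> by (auto simp: bounded_operator_def composition_operator_def o_def)
  \<comment> \<open>Monomials belong to the little space, and their images under the operator are
    the functions in (a).\<close>
  have ?monomials
    using maps[OF polynomial_little_bloch[OF assms(2) multi_power_polynomial]] by blast
  \<comment> \<open>Each index \<open>l\<close> contributes one test function of norm at most
    \<open>2 powr p\<close>. The absolute value appears because the operator bound \<open>K\<close>
    comes without a sign.\<close>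
  moreover have "\<forall>z\<in>polydisk. ?S z \<le> (\<Sum>l\<in>(UNIV::'n set). \<bar>K\<bar> * 2 powr p)"
  proof
    fix z :: "complex ^ 'n" assume z: "z \<in> polydisk"
    have \<phi>z: "\<phi> z \<in> polydisk"
      using img z by auto
    \<comment> \<open>With \<open>l\<close> outermost, a single test function accounts for the whole
      inner sum over \<open>k\<close>.\<close>
    have "?S z = (\<Sum>l\<in>UNIV. \<Sum>k\<in>UNIV. cmod (partial_deriv k (\<lambda>w. \<phi> w $ l) z) *
               ((1 - (cmod (z $ k))\<^sup>2) powr q / (1 - (cmod (\<phi> z $ l))\<^sup>2) powr p))"
      by (rule sum.swap)
    also have "\<dots> \<le> (\<Sum>l\<in>(UNIV::'n set). \<bar>K\<bar> * 2 powr p)"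
    proof (rule sum_mono)
      fix l
      have "cmod (\<phi> z $ l) < 1"
        using \<phi>z by (simp add: polydisk_def)
      from test_function[OF assms(2) this]
      obtain f where f: "f \<in> little_bloch p" "bloch_norm p f \<le> 2 powr p"
        and df: "\<And>k. cmod (partial_deriv k f (\<phi> z)) =
          (if k = l then 1 / (1 - (cmod (\<phi> z $ l))\<^sup>2) powr p else 0)"
        using \<phi>z by metis
      have fhol: "holomorphic_several f polydisk"
        using little_bloch_subset[OF f(1)] by (simp add: bloch_def)
      \<comment> \<open>The test function depends on the \<open>l\<close>-th variable only to first
        order at \<open>\<phi> z\<close>, so the chain rule collapses to one term and the inner sum
        becomes the density of the composition at \<open>z\<close>.\<close>
      have zero: "j \<noteq> l \<Longrightarrow> partial_deriv j f (\<phi> z) = 0" for j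
        using df[of j] by simp
      have "partial_deriv k (\<lambda>z. f (\<phi> z)) z =
          partial_deriv l f (\<phi> z) * partial_deriv k (\<lambda>w. \<phi> w $ l) z" for k
        unfolding partial_deriv_compose[OF fhol hol img z]
        by (subst sum.remove[of _ l]) (auto simp: zero)
      then have "(\<Sum>k\<in>UNIV. cmod (partial_deriv k (\<lambda>w. \<phi> w $ l) z) *
               ((1 - (cmod (z $ k))\<^sup>2) powr q / (1 - (cmod (\<phi> z $ l))\<^sup>2) powr p))
          = bloch_density q (\<lambda>z. f (\<phi> z)) z"
        unfolding bloch_density_def by (simp add: norm_mult df)
      also have "\<dots> \<le> bloch_norm q (\<lambda>z. f (\<phi> z))"
        using bloch_norm_ge[OF little_bloch_subset[OF maps[OF f(1)]] z] norm_ge_zero[of "f (\<phi> 0)"]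
        by linarith
      also have "\<dots> \<le> K * bloch_norm p f"
        by (rule K[OF f(1)])
      also have "\<dots> \<le> \<bar>K\<bar> * 2 powr p"
        using f(2) bloch_norm_nonneg[OF little_bloch_subset[OF f(1)]] by (intro mult_mono) auto
      finally show "(\<Sum>k\<in>UNIV. cmod (partial_deriv k (\<lambda>w. \<phi> w $ l) z) *
               ((1 - (cmod (z $ k))\<^sup>2) powr q / (1 - (cmod (\<phi> z $ l))\<^sup>2) powr p)) \<le> \<bar>K\<bar> * 2 powr p" .
    qed
    finally show "?S z \<le> (\<Sum>l\<in>(UNIV::'n set). \<bar>K\<bar> * 2 powr p)" .
  qed
  ultimately show "?monomials \<and> (\<exists>C. \<forall>z\<in>polydisk. ?S z \<le> C)"
    by blast
next
  assume R: "?monomials \<and> (\<exists>C. \<forall>z\<in>polydisk. ?S z \<le> C)"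
  then obtain C where C: "\<And>z. z \<in> polydisk \<Longrightarrow> ?S z \<le> C"
    by blast
  obtain K where "K \<ge> 0" and maps: "\<And>f. f \<in> bloch p \<Longrightarrow> (\<lambda>z. f (\<phi> z)) \<in> bloch q"
    and K: "\<And>f. f \<in> bloch p \<Longrightarrow> bloch_norm q (\<lambda>z. f (\<phi> z)) \<le> K * bloch_norm p f"
    using composition_bloch_bounded[OF assms(1,2) C] by blast
  \<comment> \<open>Composing a polynomial with \<phi> gives a finite linear combination of the
    functions in (a); this is where (a) enters.\<close>
  have poly: "(\<lambda>z. P (\<phi> z)) \<in> little_bloch q" if P: "P \<in> complex_polynomials" for P
  proof -
    obtain A a where "P = (\<lambda>z. \<Sum>\<gamma>\<in>A. a \<gamma> * multi_power z \<gamma>)"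
      using P by (auto simp: complex_polynomials_def)
    then show ?thesis
      using R by (simp add: little_bloch_sum little_bloch_scale assms(3))
  qed
  \<comment> \<open>A polynomial \<open>P\<close> near \<open>f\<close> is carried by the bounded
    operator to a member of the little space near the image of \<open>f\<close>. The tolerance is
    divided by \<open>K + 1\<close>, which is positive even when \<open>K = 0\<close>.\<close>
  have "(\<lambda>z. f (\<phi> z)) \<in> little_bloch q" if f: "f \<in> little_bloch p" for f
  proof (rule little_bloch_closed[OF assms(3) maps[OF little_bloch_subset[OF f]]])
    fix \<epsilon> :: real assume "\<epsilon> > 0"
    with \<open>K \<ge> 0\<close> have "\<epsilon> / (K + 1) > 0"
      by simp
    with f obtain P where P: "P \<in> complex_polynomials" "bloch_norm p (\<lambda>z. f z - P z) < \<epsilon> / (K + 1)"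
      unfolding little_bloch_def by blast
    have fP: "(\<lambda>z. f z - P z) \<in> bloch p"
      using little_bloch_subset[OF f] polynomial_bloch[OF assms(2) P(1)] by (rule bloch_diff)
    have "bloch_norm q (\<lambda>z. f (\<phi> z) - P (\<phi> z)) \<le> K * bloch_norm p (\<lambda>z. f z - P z)"
      by (rule K[OF fP])
    also have "\<dots> \<le> K * (\<epsilon> / (K + 1))"
      using P(2) \<open>K \<ge> 0\<close> by (intro mult_left_mono) auto
    also have "\<dots> < \<epsilon>"
      using \<open>\<epsilon> > 0\<close> \<open>K \<ge> 0\<close> by (simp add: field_simps)
    finally show "\<exists>g\<in>little_bloch q. bloch_norm q (\<lambda>z. f (\<phi> z) - g z) < \<epsilon>"
      using poly[OF P(1)] by (intro bexI[of _ "\<lambda>z. P (\<phi> z)"])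
  qed
  with K little_bloch_subset show ?bounded
    unfolding bounded_operator_def composition_operator_def o_def by blast
qed

end
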